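(* Let $\varphi_j=\binom{j+2}{2}$ for $j\ge0$ (so $\sum_j\varphi_jt^j=\frac{1}{(1-t)^3}$). For $n\ge1$ let $T_n=\sum_{T\in\mathcal{O}(n)}\big(\prod_{v\in T}\varphi_{\mathrm{outdeg}(v)}\big)\ell(T)$, the number of $3$-bundled bilabelled increasing trees with $2n$ labels, where $\ell(T)$ is the number of increasing bilabellings of $T$ with label set $\{1,\dots,2n\}$, and let $T(z)=\sum_{n\ge1}T_n\frac{z^{2n}}{(2n)!}$. Then \[T(z)=1-\sqrt{1-z^2},\qquad T_n=(2n-3)!!\,(2n-1)!!\quad(n\ge1).\]
   Context: $\mathcal{O}(n)$ is the set of ordered (planted plane) rooted trees with $n$ nodes; $\mathrm{outdeg}(v)$ is the number of children of $v$. An increasing bilabelling of a tree with $n$ nodes assigns to each node a set of exactly two integers from $\{1,\dots,2n\}$, these sets partitioning $\{1,\dots,2n\}$, such that every label of a child is larger than both labels of its parent. $(2n-1)!!=\prod_{i=1}^n(2i-1)$, with $(-1)!!=1$. *)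

theory Defs
  imports
    "HOL-Library.FuncSet"
    "HOL-Library.Disjoint_Sets"
    "HOL-Computational_Algebra.Formal_Power_Series"
begin

datatype otree = Node (children: "otree list")

text \<open>
  A node is identified with its position: the root is the empty list, and \<open>v @ [i]\<close> is the
  \<open>i\<close>-th child of \<open>v\<close>, counted from 0.
\<close>

function nodes :: "otree \<Rightarrow> nat list set" where
  "nodes (Node ts) = insert [] (\<Union>i\<in>{..<length ts}. (#) i ` nodes (ts ! i))"
  by pat_completeness auto
termination
  by (relation "measure size") (auto simp: less_Suc_eq_le intro!: size_list_estimation')

fun subtree_at :: "otree \<Rightarrow> nat list \<Rightarrow> otree" where
  "subtree_at t [] = t"
| "subtree_at (Node ts) (i # v) = subtree_at (ts ! i) v"

definition outdeg :: "otree \<Rightarrow> nat list \<Rightarrow> nat" where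
  "outdeg t v = length (children (subtree_at t v))"

definition ordered_trees :: "nat \<Rightarrow> otree set" where
  "ordered_trees n = {t. card (nodes t) = n}"

definition increasing_bilabellings :: "otree \<Rightarrow> (nat list \<Rightarrow> nat set) set" where
  "increasing_bilabellings t =
     {L \<in> nodes t \<rightarrow>\<^sub>E Pow {1..2 * card (nodes t)}.
        (\<forall>v\<in>nodes t. card (L v) = 2) \<and>
        disjoint_family_on L (nodes t) \<and>
        (\<Union>v\<in>nodes t. L v) = {1..2 * card (nodes t)} \<and>
        (\<forall>v i. v \<in> nodes t \<longrightarrow> v @ [i] \<in> nodes t \<longrightarrow>
           (\<forall>a\<in>L v. \<forall>b\<in>L (v @ [i]). a < b))}"

definition weighted_bilabelled_trees :: "(nat \<Rightarrow> nat) \<Rightarrow> nat \<Rightarrow> nat" where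
  "weighted_bilabelled_trees \<phi> n =
     (\<Sum>t\<in>ordered_trees n.
        (\<Prod>v\<in>nodes t. \<phi> (outdeg t v)) * card (increasing_bilabellings t))"

definition bundled3_weight :: "nat \<Rightarrow> nat" where
  "bundled3_weight j = (j + 2) choose 2"

definition bundled3_count :: "nat \<Rightarrow> nat" where
  "bundled3_count n = weighted_bilabelled_trees bundled3_weight n"

definition bundled3_egf :: "real fps" where
  "bundled3_egf =
     Abs_fps (\<lambda>m. if even m \<and> m \<ge> 2 then real (bundled3_count (m div 2)) / fact m else 0)"

text \<open>\<open>odd_dfact n\<close> is $(2n-1)!!$; in particular \<open>odd_dfact 0\<close> is $(-1)!! = 1$.\<close>

definition odd_dfact :: "nat \<Rightarrow> nat" where
  "odd_dfact n = (\<Prod>i=1..n. 2 * i - 1)"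

text \<open>
  The sums, products and cardinalities above range over finite sets, so the library's default
  values for infinite sets do not occur.
\<close>

lemma finite_nodes: "finite (nodes t)"
  by (induction t rule: nodes.induct) auto

lemma card_nodes_Node: "card (nodes (Node ts)) = Suc (\<Sum>i<length ts. card (nodes (ts ! i)))"
proof -
  have "card (\<Union>i\<in>{..<length ts}. (#) i ` nodes (ts ! i)) =
      (\<Sum>i<length ts. card ((#) i ` nodes (ts ! i)))"
    by (rule card_UN_disjoint) (auto simp: finite_nodes)
  also have "\<dots> = (\<Sum>i<length ts. card (nodes (ts ! i)))"
    by (intro sum.cong refl card_image) (auto intro: inj_onI)
  finally show ?thesis
    by (subst nodes.simps, subst card_insert_disjoint) (auto simp: finite_nodes)
qed

lemma card_nodes_pos: "card (nodes t) > 0"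
  by (cases t) (simp add: card_nodes_Node del: nodes.simps)

lemma finite_trees_upto: "finite {t. card (nodes t) \<le> n}"
proof (induction n)
  case 0
  have "{t. card (nodes t) \<le> 0} = {}"
    using card_nodes_pos by (metis (no_types, lifting) empty_Collect_eq linorder_not_less)
  then show ?case by (metis finite.emptyI)
next
  case (Suc n)
  let ?A = "{t. card (nodes t) \<le> n}"
  have "{t. card (nodes t) \<le> Suc n} \<subseteq> Node ` {ts. set ts \<subseteq> ?A \<and> length ts \<le> n}"
  proof
    fix t assume "t \<in> {t. card (nodes t) \<le> Suc n}"
    moreover obtain ts where t: "t = Node ts" by (cases t)
    ultimately have s: "(\<Sum>i<length ts. card (nodes (ts ! i))) \<le> n"
      by (simp add: card_nodes_Node del: nodes.simps)
    have "card (nodes (ts ! i)) \<le> n" if "i < length ts" for i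
      using member_le_sum[of i "{..<length ts}" "\<lambda>i. card (nodes (ts ! i))"] that s by simp
    moreover have "length ts \<le> (\<Sum>i<length ts. card (nodes (ts ! i)))"
      using sum_mono[of "{..<length ts}" "\<lambda>_. 1" "\<lambda>i. card (nodes (ts ! i))"] card_nodes_pos
      by (simp add: Suc_le_eq)
    ultimately show "t \<in> Node ` {ts. set ts \<subseteq> ?A \<and> length ts \<le> n}"
      using s unfolding t by (intro imageI) (auto simp: in_set_conv_nth)
  qed
  then show ?case
    using finite_lists_length_le[OF Suc.IH] by (meson finite_imageI finite_subset)
qed

lemma finite_ordered_trees: "finite (ordered_trees n)"
  by (rule finite_subset[OF _ finite_trees_upto[of n]]) (auto simp: ordered_trees_def)

lemma finite_increasing_bilabellings: "finite (increasing_bilabellings t)"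
  unfolding increasing_bilabellings_def
  by (rule finite_subset[OF _ finite_PiE[OF finite_nodes[of t],
        of "\<lambda>_. Pow {1..2 * card (nodes t)}"]]) auto

lemma bundled3_weight_gf:
  "Abs_fps (\<lambda>j. of_nat (bundled3_weight j)) = (1 / (1 - fps_X) ^ 3 :: 'a :: field_char_0 fps)"
proof -
  have rec: "Abs_fps f * (1 - fps_X) = Abs_fps (\<lambda>j. f j - (if j = 0 then 0 else f (j - 1)))"
    for f :: "nat \<Rightarrow> 'a"
    by (rule fps_ext) (simp add: algebra_simps)
  have "Abs_fps (\<lambda>j. of_nat (bundled3_weight j) :: 'a) * (1 - fps_X) =
      Abs_fps (\<lambda>j. of_nat (Suc j))"
    unfolding rec
    by (rule fps_ext)
       (auto simp: bundled3_weight_def gr0_conv_Suc numeral_2_eq_2 split: nat.splits)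
  moreover have "Abs_fps (\<lambda>j. of_nat (Suc j) :: 'a) * (1 - fps_X) = Abs_fps (\<lambda>j. 1)"
    unfolding rec by (rule fps_ext) (auto simp: gr0_conv_Suc)
  moreover have "Abs_fps (\<lambda>j. 1 :: 'a) * (1 - fps_X) = 1"
    unfolding rec by (rule fps_ext) auto
  ultimately have "Abs_fps (\<lambda>j. of_nat (bundled3_weight j) :: 'a) * (1 - fps_X) ^ 3 = 1"
    by (simp add: power3_eq_cube flip: mult.assoc)
  moreover have "(1 - fps_X :: 'a fps) ^ 3 \<noteq> 0"
    using calculation by fastforce
  ultimately show ?thesis
    by (metis nonzero_mult_div_cancel_right)
qed

end

theory Submission
  imports Defs
begin

text \<open>
  In an increasing bilabelling the root carries the two smallest labels, and the remaining ones are
  distributed freely over the subtrees. Hence the proportion \<open>\<ell>(T) / (2n)!\<close> of a tree with \<open>n\<close> nodes is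
  \<open>1 / (2n (2n - 1))\<close> times the product of the proportions of its root branches, which says
  \<open>T'' = \<phi>(T)\<close> for the generating function. For \<open>\<phi>(t) = 1 / (1 - t)\<^sup>3\<close> and \<open>S = 1 - T\<close> this is
  \<open>S'' = - 1 / S\<^sup>3\<close> with \<open>S(0) = 1\<close>, \<open>S'(0) = 0\<close>, whose solution satisfies \<open>S\<^sup>2 = 1 - z\<^sup>2\<close>. Differentiating
  once gives \<open>(1 - z\<^sup>2) S' = - z S\<close>, that is \<open>T\<^sub>n\<^sub>+\<^sub>1 = (2n - 1) (2n + 1) T\<^sub>n\<close>.
\<close>

unbundle fps_syntax

section \<open>Labellings of position sets by arbitrary label sets\<close>

text \<open>The position set \<open>V\<close> may be a tree, a single branch or a forest without its
  root, so one notion serves all stages of the recursion. Membership in \<open>Pow A\<close> need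
  not be demanded, since the union of the labels is \<open>A\<close>.\<close>

definition labellings :: "nat list set \<Rightarrow> nat set \<Rightarrow> (nat list \<Rightarrow> nat set) set" where
  "labellings V A =
     {L \<in> extensional V.
        (\<forall>v\<in>V. card (L v) = 2) \<and> disjoint_family_on L V \<and> (\<Union>v\<in>V. L v) = A \<and>
        (\<forall>v i. v \<in> V \<longrightarrow> v @ [i] \<in> V \<longrightarrow> (\<forall>a\<in>L v. \<forall>b\<in>L (v @ [i]). a < b))}"

lemma increasing_bilabellings_eq_labellings:
  "increasing_bilabellings t = labellings (nodes t) {1..2 * card (nodes t)}"
  unfolding increasing_bilabellings_def labellings_def PiE_def by auto

lemma card_UN_labels:
  assumes "finite W" "\<forall>v\<in>W. card (L v) = 2" "disjoint_family_on L W"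
  shows "card (\<Union>v\<in>W. L v) = 2 * card W"
proof -
  have "card (\<Union>v\<in>W. L v) = (\<Sum>v\<in>W. card (L v))"
    using assms by (intro card_UN_disjoint) (auto simp: disjoint_family_on_def intro: card_ge_0_finite)
  then show ?thesis using assms by simp
qed

lemma finite_labellings:
  assumes "finite V" "finite A"
  shows "finite (labellings V A)"
proof (rule finite_subset)
  show "labellings V A \<subseteq> V \<rightarrow>\<^sub>E Pow A"
    unfolding labellings_def PiE_def by auto
  show "finite (V \<rightarrow>\<^sub>E Pow A)"
    using assms by (intro finite_PiE) auto
qed

text \<open>
  Quantifying over all label sets of the right size makes the recursion over subtrees, which receive
  arbitrary label sets, go through without relabelling.
\<close>

definition uniform_labelling_density :: "nat list set \<Rightarrow> real \<Rightarrow> bool" where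
  "uniform_labelling_density V c \<longleftrightarrow>
     (\<forall>A. finite A \<longrightarrow> card A = 2 * card V \<longrightarrow>
        real (card (labellings V A)) = c * fact (2 * card V))"

lemma uniform_labelling_density_empty: "uniform_labelling_density {} 1"
proof -
  have "labellings {} {} = {\<lambda>_. undefined}"
    unfolding labellings_def by (auto simp: disjoint_family_on_def)
  then show ?thesis
    unfolding uniform_labelling_density_def by auto
qed

section \<open>Independent parts: shuffling labels\<close>

text \<open>With no edge between \<open>V\<close> and \<open>W\<close> the order condition never
  compares the two parts. A labelling is therefore a choice of the labels \<open>C\<close> that go
  to \<open>W\<close>, followed by independent labellings of both parts.\<close>

lemma bij_betw_labellings_Un:
  assumes fin: "finite V" "finite W" and disj: "V \<inter> W = {}"
    and no_edge: "\<And>v i. v \<in> V \<Longrightarrow> v @ [i] \<notin> W" "\<And>v i. v \<in> W \<Longrightarrow> v @ [i] \<notin> V"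
  shows "bij_betw (\<lambda>L. (\<Union>v\<in>W. L v, restrict L V, restrict L W)) (labellings (V \<union> W) A)
    (SIGMA C:{C. C \<subseteq> A \<and> card C = 2 * card W}. labellings V (A - C) \<times> labellings W C)"
proof (rule bij_betw_byWitness
    [where f' = "\<lambda>(C, L1, L2). \<lambda>v. if v \<in> V then L1 v else L2 v"])
  show "\<forall>L\<in>labellings (V \<union> W) A.
      (case (\<Union>v\<in>W. L v, restrict L V, restrict L W) of
        (C, L1, L2) \<Rightarrow> \<lambda>v. if v \<in> V then L1 v else L2 v) = L"
    by (auto simp: labellings_def extensional_def fun_eq_iff)
next
  show "\<forall>p\<in>(SIGMA C:{C. C \<subseteq> A \<and> card C = 2 * card W}. labellings V (A - C) \<times> labellings W C).
      (\<lambda>L. (\<Union>v\<in>W. L v, restrict L V, restrict L W))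
        (case p of (C, L1, L2) \<Rightarrow> \<lambda>v. if v \<in> V then L1 v else L2 v) = p"
  proof
    fix p
    assume "p \<in> (SIGMA C:{C. C \<subseteq> A \<and> card C = 2 * card W}. labellings V (A - C) \<times> labellings W C)"
    then obtain C L1 L2 where p: "p = (C, L1, L2)"
      and L1: "L1 \<in> labellings V (A - C)" and L2: "L2 \<in> labellings W C"
      by blast
    let ?L = "\<lambda>v. if v \<in> V then L1 v else L2 v"
    have W: "?L v = L2 v" if "v \<in> W" for v using disj that by auto
    then have "(\<Union>v\<in>W. ?L v) = C" using L2 by (simp add: labellings_def)
    moreover have "restrict ?L V = L1" "restrict ?L W = L2"
      using L1 L2 W by (auto simp: labellings_def extensional_def fun_eq_iff)
    ultimately show "(\<lambda>L. (\<Union>v\<in>W. L v, restrict L V, restrict L W))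
        (case p of (C, L1, L2) \<Rightarrow> \<lambda>v. if v \<in> V then L1 v else L2 v) = p"
      by (simp add: p)
  qed
next
  show "(\<lambda>L. (\<Union>v\<in>W. L v, restrict L V, restrict L W)) ` labellings (V \<union> W) A \<subseteq>
    (SIGMA C:{C. C \<subseteq> A \<and> card C = 2 * card W}. labellings V (A - C) \<times> labellings W C)"
  proof (rule image_subsetI)
    fix L assume "L \<in> labellings (V \<union> W) A"
    then have L: "\<forall>v\<in>V \<union> W. card (L v) = 2" "disjoint_family_on L (V \<union> W)" "(\<Union>v\<in>V \<union> W. L v) = A"
        "\<forall>v i. v \<in> V \<union> W \<longrightarrow> v @ [i] \<in> V \<union> W \<longrightarrow> (\<forall>a\<in>L v. \<forall>b\<in>L (v @ [i]). a < b)"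
      unfolding labellings_def by blast+
    have "(\<Union>v\<in>W. L v) \<subseteq> A" using L(3) by blast
    moreover have "card (\<Union>v\<in>W. L v) = 2 * card W"
      using L fin by (intro card_UN_labels) (auto simp: disjoint_family_on_def)
    moreover have "L v \<inter> L w = {}" if "v \<in> V" "w \<in> W" for v w
      using disjoint_family_onD[OF L(2)] disj that by blast
    then have "(\<Union>v\<in>V. L v) = A - (\<Union>v\<in>W. L v)"
      using L(3) by blast
    then have "restrict L V \<in> labellings V (A - (\<Union>v\<in>W. L v))"
      using L by (auto simp: labellings_def disjoint_family_on_def)
    moreover have "restrict L W \<in> labellings W (\<Union>v\<in>W. L v)"
      using L by (auto simp: labellings_def disjoint_family_on_def)
    ultimately show "(\<Union>v\<in>W. L v, restrict L V, restrict L W) \<in>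
        (SIGMA C:{C. C \<subseteq> A \<and> card C = 2 * card W}. labellings V (A - C) \<times> labellings W C)"
      by blast
  qed
next
  show "(\<lambda>(C, L1, L2). \<lambda>v. if v \<in> V then L1 v else L2 v) `
      (SIGMA C:{C. C \<subseteq> A \<and> card C = 2 * card W}. labellings V (A - C) \<times> labellings W C)
      \<subseteq> labellings (V \<union> W) A"
  proof (rule image_subsetI)
    fix p
    assume "p \<in> (SIGMA C:{C. C \<subseteq> A \<and> card C = 2 * card W}. labellings V (A - C) \<times> labellings W C)"
    then obtain C L1 L2 where p: "p = (C, L1, L2)" and C: "C \<subseteq> A"
      and L1: "L1 \<in> labellings V (A - C)" and L2: "L2 \<in> labellings W C"
      by blast
    let ?L = "\<lambda>v. if v \<in> V then L1 v else L2 v"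
    have W: "v \<notin> V" if "v \<in> W" for v using disj that by blast
    have cross: "L1 v \<inter> L2 w = {}" if "v \<in> V" "w \<in> W" for v w
      using L1 L2 that unfolding labellings_def by blast
    have "?L \<in> extensional (V \<union> W)"
      using L2 by (auto simp: labellings_def extensional_def)
    moreover have "\<forall>v\<in>V \<union> W. card (?L v) = 2"
      using L1 L2 W by (auto simp: labellings_def)
    moreover have "disjoint_family_on ?L (V \<union> W)"
    proof (unfold disjoint_family_on_def, intro ballI impI)
      fix v w assume "v \<in> V \<union> W" "w \<in> V \<union> W" "v \<noteq> w"
      then consider "v \<in> V" "w \<in> V" | "v \<in> V" "w \<in> W" | "v \<in> W" "w \<in> V" | "v \<in> W" "w \<in> W"
        by blast
      then show "?L v \<inter> ?L w = {}"
        using L1 L2 cross W \<open>v \<noteq> w\<close>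
        by cases (simp_all add: labellings_def disjoint_family_on_def Int_commute)
    qed
    moreover have "(\<Union>v\<in>V \<union> W. ?L v) = A"
    proof -
      have "(\<Union>v\<in>V \<union> W. ?L v) = (\<Union>v\<in>V. L1 v) \<union> (\<Union>v\<in>W. L2 v)"
        using W by auto
      then show ?thesis using L1 L2 C by (auto simp: labellings_def)
    qed
    moreover have "a < b" if "v \<in> V \<union> W" "v @ [i] \<in> V \<union> W" "a \<in> ?L v" "b \<in> ?L (v @ [i])" for v i a b
    proof (cases "v \<in> V")
      case True
      then show ?thesis using that no_edge L1 by (auto simp: labellings_def)
    next
      case False
      then have "v \<in> W" "v @ [i] \<notin> V" using that no_edge by auto
      then show ?thesis using that False L2 by (auto simp: labellings_def)
    qed
    ultimately have "?L \<in> labellings (V \<union> W) A"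
      unfolding labellings_def by blast
    then show "(case p of (C, L1, L2) \<Rightarrow> \<lambda>v. if v \<in> V then L1 v else L2 v) \<in> labellings (V \<union> W) A"
      by (simp add: p)
  qed
qed

text \<open>The number of choices of \<open>C\<close> is a binomial coefficient, and it turns the
  product of the factorials of both parts into the factorial of the whole. Hence densities simply
  multiply.\<close>

lemma uniform_labelling_density_Un:
  assumes fin: "finite V" "finite W" and disj: "V \<inter> W = {}"
    and no_edge: "\<And>v i. v \<in> V \<Longrightarrow> v @ [i] \<notin> W" "\<And>v i. v \<in> W \<Longrightarrow> v @ [i] \<notin> V"
    and c: "uniform_labelling_density V c" and d: "uniform_labelling_density W d"
  shows "uniform_labelling_density (V \<union> W) (c * d)"
  unfolding uniform_labelling_density_def
proof (intro allI impI)
  fix A :: "nat set" assume A: "finite A" "card A = 2 * card (V \<union> W)"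
  let ?n = "card V" and ?m = "card W"
  have cardA: "card A = 2 * ?n + 2 * ?m"
    using A fin disj by (simp add: card_Un_disjoint)
  let ?S = "{C. C \<subseteq> A \<and> card C = 2 * ?m}"
  have finS: "finite ?S" using A by simp
  have "card (labellings (V \<union> W) A) =
      card (SIGMA C:?S. labellings V (A - C) \<times> labellings W C)"
    using bij_betw_labellings_Un[OF fin disj no_edge] by (rule bij_betw_same_card)
  also have "\<dots> = (\<Sum>C\<in>?S. card (labellings V (A - C) \<times> labellings W C))"
    using A fin finS by (intro card_SigmaI) (auto intro!: finite_labellings intro: finite_subset)
  also have "\<dots> = (\<Sum>C\<in>?S. card (labellings V (A - C)) * card (labellings W C))"
    by (simp add: card_cartesian_product)
  finally have "real (card (labellings (V \<union> W) A)) =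
      (\<Sum>C\<in>?S. real (card (labellings V (A - C))) * real (card (labellings W C)))"
    by simp
  also have "\<dots> = (\<Sum>C\<in>?S. (c * fact (2 * ?n)) * (d * fact (2 * ?m)))"
  proof (intro sum.cong refl, goal_cases)
    case (1 C)
    then have C: "C \<subseteq> A" "card C = 2 * ?m" by auto
    then have "finite C" using A finite_subset by blast
    moreover have "card (A - C) = 2 * ?n"
      using C cardA \<open>finite C\<close> by (simp add: card_Diff_subset)
    ultimately show ?case
      using c d C A unfolding uniform_labelling_density_def by simp
  qed
  also have "\<dots> = real (card A choose (2 * ?m)) * ((c * fact (2 * ?n)) * (d * fact (2 * ?m)))"
    using n_subsets[OF A(1)] by simp
  also have "\<dots> = c * d * (fact (2 * ?m) * fact (2 * ?n) * real (card A choose (2 * ?m)))"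
    by simp
  also have "fact (2 * ?m) * fact (2 * ?n) * real (card A choose (2 * ?m)) = fact (card A)"
    using binomial_fact_lemma[of "2 * ?m" "card A"] cardA
    by (metis add.commute add_diff_cancel_right' le_add2 of_nat_fact of_nat_mult)
  finally show "real (card (labellings (V \<union> W) A)) = c * d * fact (2 * card (V \<union> W))"
    by (simp add: A)
qed

text \<open>Putting \<open>i\<close> in front of every position keeps the parent-child relation,
  because \<open>(i # v) @ [j] = i # (v @ [j])\<close>; labellings can be transported both
  ways.\<close>

lemma card_labellings_Cons_image: "card (labellings ((#) i ` V) A) = card (labellings V A)"
proof -
  have "bij_betw (\<lambda>L. \<lambda>v\<in>V. L (i # v)) (labellings ((#) i ` V) A) (labellings V A)"
  proof (rule bij_betw_byWitness[where f' = "\<lambda>L. \<lambda>w\<in>(#) i ` V. L (tl w)"])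
    show "\<forall>L\<in>labellings ((#) i ` V) A. (\<lambda>w\<in>(#) i ` V. (\<lambda>v\<in>V. L (i # v)) (tl w)) = L"
      by (auto simp: labellings_def extensional_def fun_eq_iff restrict_def)
    show "\<forall>L\<in>labellings V A. (\<lambda>v\<in>V. (\<lambda>w\<in>(#) i ` V. L (tl w)) (i # v)) = L"
      by (auto simp: labellings_def extensional_def fun_eq_iff restrict_def)
    show "(\<lambda>L. \<lambda>v\<in>V. L (i # v)) ` labellings ((#) i ` V) A \<subseteq> labellings V A"
    proof (rule image_subsetI)
      fix L assume "L \<in> labellings ((#) i ` V) A"
      then have L: "\<forall>v\<in>V. card (L (i # v)) = 2"
          "\<forall>v\<in>V. \<forall>w\<in>V. v \<noteq> w \<longrightarrow> L (i # v) \<inter> L (i # w) = {}" "(\<Union>v\<in>V. L (i # v)) = A"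
        and edge: "v \<in> (#) i ` V \<Longrightarrow> v @ [j] \<in> (#) i ` V \<Longrightarrow> \<forall>a\<in>L v. \<forall>b\<in>L (v @ [j]). a < b" for v j
        by (auto simp: labellings_def disjoint_family_on_def)
      have "\<forall>a\<in>L (i # v). \<forall>b\<in>L (i # v @ [j]). a < b" if "v \<in> V" "v @ [j] \<in> V" for v j
        using edge[of "i # v" j] that by auto
      with L show "(\<lambda>v\<in>V. L (i # v)) \<in> labellings V A"
        by (simp add: labellings_def disjoint_family_on_def)
    qed
    show "(\<lambda>L. \<lambda>w\<in>(#) i ` V. L (tl w)) ` labellings V A \<subseteq> labellings ((#) i ` V) A"
    proof (rule image_subsetI)
      fix L assume L: "L \<in> labellings V A"
      let ?L = "\<lambda>w\<in>(#) i ` V. L (tl w)"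
      have "a < b" if "v \<in> (#) i ` V" "v @ [j] \<in> (#) i ` V" "a \<in> ?L v" "b \<in> ?L (v @ [j])" for v j a b
        using that L by (auto simp: labellings_def)
      moreover have "disjoint_family_on ?L ((#) i ` V)"
        using L by (simp add: labellings_def disjoint_family_on_def)
      moreover have "\<forall>v\<in>(#) i ` V. card (?L v) = 2" "(\<Union>v\<in>(#) i ` V. ?L v) = A"
        using L by (simp_all add: labellings_def)
      ultimately show "?L \<in> labellings ((#) i ` V) A"
        unfolding labellings_def by blast
    qed
  qed
  then show ?thesis by (rule bij_betw_same_card)
qed

lemma uniform_labelling_density_Cons_image:
  assumes "uniform_labelling_density V c"
  shows "uniform_labelling_density ((#) i ` V) c"
  using assms
  by (simp add: uniform_labelling_density_def card_labellings_Cons_image card_image)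

section \<open>Attaching a root\<close>

lemma initial_pair_exists:
  fixes A :: "'a :: linorder set"
  assumes "finite A" "card A \<ge> 2"
  obtains R where "R \<subseteq> A" "card R = 2" "\<forall>a\<in>R. \<forall>b\<in>A - R. a < b"
proof -
  define x where "x = Min A"
  define y where "y = Min (A - {x})"
  have "A \<noteq> {}" using assms by auto
  then have x: "x \<in> A" "\<forall>a\<in>A. x \<le> a" using assms by (auto simp: x_def)
  then have "card (A - {x}) \<ge> 1" using assms by simp
  then have "A - {x} \<noteq> {}" by force
  then have y: "y \<in> A - {x}" "\<forall>a\<in>A - {x}. y \<le> a"
    using assms Min_in[of "A - {x}"] unfolding y_def by (auto simp del: Diff_iff)
  show thesis
  proof (rule that[of "{x, y}"])
    show "\<forall>a\<in>{x, y}. \<forall>b\<in>A - {x, y}. a < b"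
      using x y by (auto simp: order.strict_iff_order)
  qed (use x y in auto)
qed

text \<open>Two different sets of equal finite size each contain an element missing from the other,
  and these two elements would have to be smaller than one another.\<close>

lemma initial_subset_unique:
  fixes A :: "'a :: linorder set"
  assumes "finite A" "R \<subseteq> A" "R' \<subseteq> A" "card R = card R'"
    and "\<forall>a\<in>R. \<forall>b\<in>A - R. a < b" "\<forall>a\<in>R'. \<forall>b\<in>A - R'. a < b"
  shows "R = R'"
proof (rule ccontr)
  assume "R \<noteq> R'"
  moreover have "finite R" "finite R'" using assms(1-3) by (auto intro: finite_subset)
  ultimately have "\<not> R \<subseteq> R'" "\<not> R' \<subseteq> R"
    using assms(4) card_subset_eq by metis+
  then obtain x y where "x \<in> R - R'" "y \<in> R' - R" by blast
  then have "x < y" "y < x" using assms by blast+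
  then show False by simp
qed

text \<open>The local condition propagates along the path from the root. Reverse list induction fits
  because the parent of \<open>v @ [i]\<close> is \<open>v\<close>.\<close>

lemma root_labels_less:
  assumes L: "L \<in> labellings V A" and prefix: "\<And>v i. v @ [i] \<in> V \<Longrightarrow> v \<in> V"
    and "v \<in> V" "v \<noteq> []" "a \<in> L []" "b \<in> L v"
  shows "a < b"
  using assms(3-)
proof (induction v arbitrary: b rule: rev_induct)
  case Nil
  then show ?case by simp
next
  case (snoc i v)
  have v: "v \<in> V" using prefix snoc.prems by blast
  have step: "\<forall>c\<in>L v. c < b"
    using L v snoc.prems unfolding labellings_def by blast
  show ?case
  proof (cases "v = []")
    case True
    then show ?thesis using step snoc.prems by blast
  next
    case False
    \<comment> \<open>The comparison passes through a label of the parent, so the parent must have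
      one.\<close>
    have "card (L v) = 2" using L v unfolding labellings_def by blast
    then obtain c where "c \<in> L v" by fastforce
    then show ?thesis using snoc.IH[OF v False] snoc.prems step by fastforce
  qed
qed

text \<open>The labels of the root lie below all others, which forces them to be \<open>R\<close>,
  so deleting the root loses no information. Conversely, \<open>R\<close> at the root never violates
  the order, since all other labels come from \<open>A - R\<close>.\<close>

lemma card_labellings_insert_root:
  assumes fin: "finite A" and root: "[] \<notin> V"
    and prefix: "\<And>v i. v @ [i] \<in> V \<Longrightarrow> v \<in> insert [] V"
    and R: "R \<subseteq> A" "card R = 2" "\<forall>a\<in>R. \<forall>b\<in>A - R. a < b"
  shows "card (labellings (insert [] V) A) = card (labellings V (A - R))"
proof -
  have root_labels: "L [] = R" if L: "L \<in> labellings (insert [] V) A" for L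
  proof (rule initial_subset_unique[OF fin])
    show "L [] \<subseteq> A" "card (L []) = card R"
      using L R(2) by (auto simp: labellings_def)
    have "a < b" if "a \<in> L []" "b \<in> A - L []" for a b
    proof -
      from that L obtain v where "v \<in> insert [] V" "v \<noteq> []" "b \<in> L v"
        unfolding labellings_def by blast
      then show ?thesis
        using root_labels_less[OF L] prefix that by blast
    qed
    then show "\<forall>a\<in>L []. \<forall>b\<in>A - L []. a < b" by blast
  qed (use R in auto)
  have "bij_betw (\<lambda>L. restrict L V) (labellings (insert [] V) A) (labellings V (A - R))"
  proof (rule bij_betw_byWitness[where f' = "\<lambda>L. L([] := R)"])
    show "\<forall>L\<in>labellings (insert [] V) A. (restrict L V)([] := R) = L"
      using root_labels by (auto simp: labellings_def extensional_def fun_eq_iff)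
    show "\<forall>L\<in>labellings V (A - R). restrict (L([] := R)) V = L"
      using root by (auto simp: labellings_def extensional_def fun_eq_iff)
    show "(\<lambda>L. restrict L V) ` labellings (insert [] V) A \<subseteq> labellings V (A - R)"
    proof clarify
      fix L assume L: "L \<in> labellings (insert [] V) A"
      have "L [] \<union> (\<Union>v\<in>V. L v) = A" "L [] \<inter> (\<Union>v\<in>V. L v) = {}"
        using L root unfolding labellings_def disjoint_family_on_def by auto
      then have "(\<Union>v\<in>V. L v) = A - R" using root_labels[OF L] by blast
      then show "restrict L V \<in> labellings V (A - R)"
        using L by (auto simp: labellings_def disjoint_family_on_def)
    qed
    show "(\<lambda>L. L([] := R)) ` labellings V (A - R) \<subseteq> labellings (insert [] V) A"
    proof clarify
      fix L assume L: "L \<in> labellings V (A - R)"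
      let ?L = "L([] := R)"
      have U: "(\<Union>v\<in>V. L v) = A - R" using L by (simp add: labellings_def)
      have V: "?L v = L v" if "v \<in> V" for v using root that by auto
      have "?L \<in> extensional (insert [] V)"
        using L by (auto simp: labellings_def extensional_def)
      moreover have "\<forall>v\<in>insert [] V. card (?L v) = 2"
        using L R(2) by (auto simp: labellings_def)
      moreover have "disjoint_family_on ?L (insert [] V)"
        using L U root unfolding labellings_def disjoint_family_on_def by auto
      moreover have "(\<Union>v\<in>insert [] V. ?L v) = A"
      proof -
        have "(\<Union>v\<in>V. ?L v) = A - R"
          unfolding U[symmetric] by (rule SUP_cong[OF refl V])
        then show ?thesis using R(1) by (simp only: UN_insert fun_upd_same) blast
      qed
      moreover have "a < b" if "v \<in> insert [] V" "v @ [i] \<in> insert [] V" "a \<in> ?L v"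
        "b \<in> ?L (v @ [i])" for v i a b
      proof (cases "v = []")
        case True
        then have "a \<in> R" "b \<in> A - R" using that U by auto
        then show ?thesis using R(3) by blast
      next
        case False
        then show ?thesis using that L by (auto simp: labellings_def)
      qed
      ultimately show "?L \<in> labellings (insert [] V) A"
        unfolding labellings_def by blast
    qed
  qed
  then show ?thesis by (rule bij_betw_same_card)
qed

text \<open>The number of labellings stays the same while the factorial in the denominator grows by
  two factors.\<close>

lemma uniform_labelling_density_insert_root:
  assumes fin: "finite V" and root: "[] \<notin> V"
    and prefix: "\<And>v i. v @ [i] \<in> V \<Longrightarrow> v \<in> insert [] V"
    and c: "uniform_labelling_density V c"
  shows "uniform_labelling_density (insert [] V)
    (c / (real (2 * card V + 2) * real (2 * card V + 1)))"
  unfolding uniform_labelling_density_def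
proof (intro allI impI)
  fix A :: "nat set" assume A: "finite A" "card A = 2 * card (insert [] V)"
  then have cardA: "card A = 2 * card V + 2" using fin root by simp
  then obtain R where R: "R \<subseteq> A" "card R = 2" "\<forall>a\<in>R. \<forall>b\<in>A - R. a < b"
    using initial_pair_exists[of A] A by auto
  have "card (A - R) = 2 * card V"
    using R cardA A by (simp add: card_Diff_subset finite_subset)
  then have "real (card (labellings (insert [] V) A)) = c * fact (2 * card V)"
    using c A card_labellings_insert_root[OF A(1) root prefix R]
    unfolding uniform_labelling_density_def by simp
  moreover have "fact (2 * card (insert [] V)) =
      real (2 * card V + 2) * real (2 * card V + 1) * fact (2 * card V)"
    using fin root by (simp add: algebra_simps)
  ultimately show "real (card (labellings (insert [] V) A)) =
      c / (real (2 * card V + 2) * real (2 * card V + 1)) * fact (2 * card (insert [] V))"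
    by simp
qed

section \<open>The density of a tree\<close>

definition bilabelling_density :: "otree \<Rightarrow> real" where
  "bilabelling_density t = card (increasing_bilabellings t) / fact (2 * card (nodes t))"

text \<open>The standard label set is one admissible choice of \<open>A\<close>, so it identifies
  the constant.\<close>

lemma bilabelling_density_eqI:
  assumes "uniform_labelling_density (nodes t) c"
  shows "bilabelling_density t = c"
  using assms
  by (simp add: uniform_labelling_density_def bilabelling_density_def
      increasing_bilabellings_eq_labellings)

lemma nodes_prefix_closed: "v @ [i] \<in> nodes t \<Longrightarrow> v \<in> nodes t"
proof (induction v arbitrary: t)
  case Nil
  then show ?case by (cases t) auto
next
  case (Cons j v)
  then show ?case by (cases t) auto
qed

text \<open>Positions in different branches begin with different indices, so the branches are
  disjoint and no edge joins them.\<close>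

lemma uniform_labelling_density_forest:
  assumes "\<And>i. i < k \<Longrightarrow> uniform_labelling_density (nodes (f i)) (c i)"
  shows "uniform_labelling_density (\<Union>i<k. (#) i ` nodes (f i)) (\<Prod>i<k. c i)"
  using assms
proof (induction k)
  case 0
  then show ?case by (simp add: uniform_labelling_density_empty)
next
  case (Suc k)
  have "uniform_labelling_density ((\<Union>i<k. (#) i ` nodes (f i)) \<union> (#) k ` nodes (f k))
      ((\<Prod>i<k. c i) * c k)"
    using Suc
    by (intro uniform_labelling_density_Un uniform_labelling_density_Cons_image)
      (auto simp: finite_nodes)
  then show ?case by (simp add: lessThan_Suc Un_commute mult.commute)
qed

lemma uniform_labelling_density_Node:
  assumes "\<And>i. i < length ts \<Longrightarrow> uniform_labelling_density (nodes (ts ! i)) (c i)"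
  defines "n \<equiv> card (nodes (Node ts))"
  shows "uniform_labelling_density (nodes (Node ts))
    ((\<Prod>i<length ts. c i) / (real (2 * n) * real (2 * n - 1)))"
proof -
  let ?V = "\<Union>i<length ts. (#) i ` nodes (ts ! i)"
  have nodes: "nodes (Node ts) = insert [] ?V" by simp
  have "[] \<notin> ?V" "finite ?V" by (auto simp: finite_nodes)
  \<comment> \<open>Since \<open>n\<close> is positive, the natural subtraction in
    \<open>2 * n - 1\<close> does not truncate and gives \<open>2 * card ?V + 1\<close>.\<close>
  then have n: "n = card ?V + 1" unfolding n_def nodes by simp
  have "v \<in> insert [] ?V" if "v @ [i] \<in> ?V" for v i
    using nodes_prefix_closed[of v i "Node ts"] that unfolding nodes by blast
  then have "uniform_labelling_density (insert [] ?V)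
      ((\<Prod>i<length ts. c i) / (real (2 * card ?V + 2) * real (2 * card ?V + 1)))"
    using \<open>[] \<notin> ?V\<close> \<open>finite ?V\<close> assms(1)
    by (intro uniform_labelling_density_insert_root uniform_labelling_density_forest)
  then show ?thesis unfolding nodes n by simp
qed

lemma uniform_labelling_density_nodes: "uniform_labelling_density (nodes t) (bilabelling_density t)"
proof -
  have "\<exists>c. uniform_labelling_density (nodes t) c"
  proof (induction t)
    case (Node ts)
    \<comment> \<open>The bound on \<open>i\<close> is moved below the existential quantifier so
      that \<open>choice\<close> yields a total function.\<close>
    then have "\<forall>i. \<exists>c. i < length ts \<longrightarrow> uniform_labelling_density (nodes (ts ! i)) c"
      using nth_mem by blast
    then have "\<exists>c. \<forall>i. i < length ts \<longrightarrow> uniform_labelling_density (nodes (ts ! i)) (c i)"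
      by (rule choice)
    then show ?case using uniform_labelling_density_Node by blast
  qed
  then show ?thesis using bilabelling_density_eqI by blast
qed

text \<open>Unfolded over all nodes, this is a hook length formula: a node whose subtree has h nodes
  contributes the factor 1 / (2h (2h - 1)).\<close>

lemma bilabelling_density_Node:
  fixes ts
  defines "n \<equiv> card (nodes (Node ts))"
  shows "bilabelling_density (Node ts) =
    (\<Prod>i<length ts. bilabelling_density (ts ! i)) / (real (2 * n) * real (2 * n - 1))"
  unfolding n_def
  by (intro bilabelling_density_eqI uniform_labelling_density_Node uniform_labelling_density_nodes)

section \<open>Weights of trees and forests\<close>

text \<open>Taking the density instead of the count absorbs the factorials of the exponential
  generating function, so products of series need no binomial coefficients.\<close>

definition tree_weight :: "(nat \<Rightarrow> nat) \<Rightarrow> otree \<Rightarrow> real" where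
  "tree_weight \<phi> t = real (\<Prod>v\<in>nodes t. \<phi> (outdeg t v)) * bilabelling_density t"

lemma prod_outdeg_Node:
  "(\<Prod>v\<in>nodes (Node ts). \<phi> (outdeg (Node ts) v)) =
     \<phi> (length ts) * (\<Prod>i<length ts. \<Prod>v\<in>nodes (ts ! i). \<phi> (outdeg (ts ! i) v))"
  for \<phi> :: "nat \<Rightarrow> 'a :: comm_monoid_mult"
proof -
  let ?V = "\<Union>i<length ts. (#) i ` nodes (ts ! i)"
  have "(\<Prod>v\<in>nodes (Node ts). \<phi> (outdeg (Node ts) v)) =
      \<phi> (outdeg (Node ts) []) * (\<Prod>v\<in>?V. \<phi> (outdeg (Node ts) v))"
    unfolding nodes.simps by (rule prod.insert) (auto simp: finite_nodes)
  also have "(\<Prod>v\<in>?V. \<phi> (outdeg (Node ts) v)) =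
      (\<Prod>i<length ts. \<Prod>v\<in>(#) i ` nodes (ts ! i). \<phi> (outdeg (Node ts) v))"
    by (rule prod.UNION_disjoint) (auto simp: finite_nodes)
  also have "\<dots> = (\<Prod>i<length ts. \<Prod>v\<in>nodes (ts ! i). \<phi> (outdeg (ts ! i) v))"
    by (rule prod.cong[OF refl], subst prod.reindex) (auto simp: outdeg_def)
  finally show ?thesis by (simp add: outdeg_def)
qed

text \<open>The denominator is cleared because its factors are those that two differentiations bring
  down from the power with exponent \<open>2 * n\<close>.\<close>

lemma tree_weight_Node:
  fixes ts
  defines "n \<equiv> card (nodes (Node ts))"
  shows "real (2 * n) * real (2 * n - 1) * tree_weight \<phi> (Node ts) =
    \<phi> (length ts) * (\<Prod>t\<leftarrow>ts. tree_weight \<phi> t)"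
proof -
  have "n > 0" unfolding n_def by (rule card_nodes_pos)
  then have "real (2 * n) * real (2 * n - 1) \<noteq> 0" by simp
  then have "real (2 * n) * real (2 * n - 1) * bilabelling_density (Node ts) =
      (\<Prod>i<length ts. bilabelling_density (ts ! i))"
    unfolding bilabelling_density_Node n_def by simp
  moreover have "(\<Prod>t\<leftarrow>ts. tree_weight \<phi> t) = (\<Prod>i<length ts. tree_weight \<phi> (ts ! i))"
    by (simp add: prod.list_conv_set_nth atLeast0LessThan)
  ultimately show ?thesis
    unfolding tree_weight_def prod_outdeg_Node by (simp add: prod.distrib del: nodes.simps)
qed

text \<open>Size is counted in labels, two per node, to agree with the exponents in
  \<open>tree_egf\<close>.\<close>

definition forests :: "nat \<Rightarrow> nat \<Rightarrow> otree list set" where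
  "forests k m = {ts. length ts = k \<and> (\<Sum>t\<leftarrow>ts. 2 * card (nodes t)) = m}"

lemma finite_trees_size: "finite {t. 2 * card (nodes t) = m}"
  by (rule finite_subset[OF _ finite_trees_upto[of m]]) auto

text \<open>The size \<open>i\<close> of the first tree is kept as a separate index to match the
  Cauchy product.\<close>

lemma forests_Suc:
  "forests (Suc k) m =
     (\<lambda>(i, t, ts). t # ts) ` (SIGMA i:{0..m}. {t. 2 * card (nodes t) = i} \<times> forests k (m - i))"
  (is "_ = ?f ` ?S")
proof
  show "forests (Suc k) m \<subseteq> ?f ` ?S"
  proof
    fix ts assume "ts \<in> forests (Suc k) m"
    then obtain t ts' where ts: "ts = t # ts'" "length ts' = k"
        "2 * card (nodes t) + (\<Sum>t\<leftarrow>ts'. 2 * card (nodes t)) = m"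
      by (cases ts) (auto simp: forests_def)
    then have "(2 * card (nodes t), t, ts') \<in> ?S" by (auto simp: forests_def)
    then show "ts \<in> ?f ` ?S" using ts(1) by force
  qed
qed (auto simp: forests_def)

lemma finite_forests: "finite (forests k m)"
proof (induction k arbitrary: m)
  case 0
  then show ?case by (auto simp: forests_def intro: finite_subset[of _ "{[]}"])
next
  case (Suc k)
  then show ?case by (auto simp: forests_Suc finite_trees_size)
qed

section \<open>The generating function and its differential equation\<close>

definition tree_egf :: "(nat \<Rightarrow> nat) \<Rightarrow> real fps" where
  "tree_egf \<phi> = Abs_fps (\<lambda>m. \<Sum>t | 2 * card (nodes t) = m. tree_weight \<phi> t)"

text \<open>Weights are multiplicative and sizes additive over a list of trees, so a power of the
  series enumerates forests with that many trees.\<close>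

lemma tree_egf_power_nth:
  "tree_egf \<phi> ^ k $ m = (\<Sum>ts\<in>forests k m. \<Prod>t\<leftarrow>ts. tree_weight \<phi> t)"
proof (induction k arbitrary: m)
  case 0
  have "forests 0 m = (if m = 0 then {[]} else {})" by (auto simp: forests_def)
  then show ?case by simp
next
  case (Suc k)
  let ?w = "\<lambda>ts. \<Prod>t\<leftarrow>ts. tree_weight \<phi> t"
  let ?S = "SIGMA i:{0..m}. {t. 2 * card (nodes t) = i} \<times> forests k (m - i)"
  have "tree_egf \<phi> ^ Suc k $ m =
      (\<Sum>i=0..m. (\<Sum>t | 2 * card (nodes t) = i. tree_weight \<phi> t) * (\<Sum>ts\<in>forests k (m - i). ?w ts))"
    by (simp add: fps_mult_nth Suc.IH) (simp add: tree_egf_def)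
  also have "\<dots> = (\<Sum>i=0..m. \<Sum>(t, ts)\<in>{t. 2 * card (nodes t) = i} \<times> forests k (m - i). ?w (t # ts))"
    by (simp add: sum_product sum.cartesian_product)
  also have "\<dots> = (\<Sum>(i, t, ts)\<in>?S. ?w (t # ts))"
    by (subst sum.Sigma) (auto simp: finite_trees_size finite_forests)
  \<comment> \<open>Forgetting \<open>i\<close> is injective on \<open>?S\<close>, as
    \<open>i\<close> is the size of \<open>t\<close>.\<close>
  also have "\<dots> = (\<Sum>ts\<in>forests (Suc k) m. ?w ts)"
    unfolding forests_Suc
    by (subst sum.reindex) (auto simp: inj_on_def case_prod_unfold)
  finally show ?case .
qed

lemma length_le_forest_size: "length ts \<le> (\<Sum>t\<leftarrow>ts. 2 * card (nodes t))"
proof (induction ts)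
  case (Cons t ts)
  then show ?case using card_nodes_pos[of t] by simp
qed simp

text \<open>Removing the root turns a tree of size \<open>m + 2\<close> into a forest of size
  \<open>m\<close>. The factors from differentiating cancel the denominator of the root, and
  grouping forests by length yields the composition with the weight series.\<close>

theorem tree_egf_deriv2:
  "fps_deriv (fps_deriv (tree_egf \<phi>)) = Abs_fps (\<lambda>j. real (\<phi> j)) oo tree_egf \<phi>"
proof (rule fps_ext)
  fix m
  let ?w = "\<lambda>ts. \<Prod>t\<leftarrow>ts. tree_weight \<phi> t"
  let ?F = "{ts. (\<Sum>t\<leftarrow>ts. 2 * card (nodes t)) = m}"
  have size_Node: "2 * card (nodes (Node ts)) = (\<Sum>t\<leftarrow>ts. 2 * card (nodes t)) + 2" for ts
    by (simp add: card_nodes_Node sum.list_conv_set_nth atLeast0LessThan sum_distrib_left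
        del: nodes.simps)
  have trees: "{t. 2 * card (nodes t) = m + 2} = Node ` ?F"
  proof (intro set_eqI iffI)
    fix t assume "t \<in> {t. 2 * card (nodes t) = m + 2}"
    then show "t \<in> Node ` ?F" using size_Node by (cases t) (auto simp del: nodes.simps)
  qed (use size_Node in auto)
  \<comment> \<open>Every tree has positive size, so at most \<open>m\<close> branches occur; this
    is the range of the finite sum defining a coefficient of the composition.\<close>
  have F: "?F = (\<Union>k\<in>{0..m}. forests k m)"
    using length_le_forest_size by (auto simp: forests_def)
  have "fps_deriv (fps_deriv (tree_egf \<phi>)) $ m =
      (\<Sum>t | 2 * card (nodes t) = m + 2. real (m + 2) * real (m + 1) * tree_weight \<phi> t)"
    by (simp add: tree_egf_def sum_distrib_left algebra_simps)
  also have "\<dots> = (\<Sum>ts\<in>?F. real (m + 2) * real (m + 1) * tree_weight \<phi> (Node ts))"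
    unfolding trees by (subst sum.reindex) (auto simp: inj_on_def)
  also have "\<dots> = (\<Sum>ts\<in>?F. \<phi> (length ts) * ?w ts)"
  proof (intro sum.cong refl)
    fix ts assume "ts \<in> ?F"
    then have "2 * card (nodes (Node ts)) = m + 2" using size_Node by simp
    then show "real (m + 2) * real (m + 1) * tree_weight \<phi> (Node ts) = \<phi> (length ts) * ?w ts"
      using tree_weight_Node[of ts \<phi>] by simp
  qed
  also have "\<dots> = (\<Sum>k=0..m. \<Sum>ts\<in>forests k m. \<phi> (length ts) * ?w ts)"
    unfolding F by (rule sum.UNION_disjoint) (auto simp: finite_forests, auto simp: forests_def)
  also have "\<dots> = (\<Sum>k=0..m. \<phi> k * (\<Sum>ts\<in>forests k m. ?w ts))"
    by (simp add: sum_distrib_left forests_def)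
  also have "\<dots> = (Abs_fps (\<lambda>j. real (\<phi> j)) oo tree_egf \<phi>) $ m"
    by (simp add: fps_compose_nth tree_egf_power_nth)
  finally show "fps_deriv (fps_deriv (tree_egf \<phi>)) $ m =
      (Abs_fps (\<lambda>j. real (\<phi> j)) oo tree_egf \<phi>) $ m" .
qed

section \<open>Specialization to 3-bundled trees\<close>

lemma tree_egf_nth_odd: "odd m \<Longrightarrow> tree_egf \<phi> $ m = 0"
proof -
  assume "odd m"
  then have "{t. 2 * card (nodes t) = m} = {}" by auto
  then show ?thesis by (simp add: tree_egf_def)
qed

lemma tree_egf_nth_0: "tree_egf \<phi> $ 0 = 0"
proof -
  have "{t. 2 * card (nodes t) = 0} = {}" using card_nodes_pos by auto
  then show ?thesis unfolding tree_egf_def by (simp only: fps_nth_Abs_fps sum.empty)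
qed

lemma tree_egf_nth_even:
  "tree_egf \<phi> $ (2 * n) = real (weighted_bilabelled_trees \<phi> n) / fact (2 * n)"
proof -
  have "tree_egf \<phi> $ (2 * n) = (\<Sum>t\<in>ordered_trees n. tree_weight \<phi> t)"
    by (simp add: tree_egf_def ordered_trees_def)
  also have "\<dots> = (\<Sum>t\<in>ordered_trees n.
      real ((\<Prod>v\<in>nodes t. \<phi> (outdeg t v)) * card (increasing_bilabellings t)) / fact (2 * n))"
    by (intro sum.cong refl)
      (simp add: tree_weight_def bilabelling_density_def ordered_trees_def)
  also have "\<dots> = real (weighted_bilabelled_trees \<phi> n) / fact (2 * n)"
    by (simp add: weighted_bilabelled_trees_def flip: sum_divide_distrib)
  finally show ?thesis .
qed

lemma bundled3_egf_eq_tree_egf: "bundled3_egf = tree_egf bundled3_weight"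
proof (rule fps_ext)
  fix m
  show "bundled3_egf $ m = tree_egf bundled3_weight $ m"
  proof (cases "even m")
    case True
    then obtain n where m: "m = 2 * n" by blast
    show ?thesis
    proof (cases "n = 0")
      case True
      then show ?thesis by (simp add: m bundled3_egf_def tree_egf_nth_0)
    next
      case False
      then show ?thesis by (simp add: m bundled3_egf_def tree_egf_nth_even bundled3_count_def)
    qed
  next
    case False
    then show ?thesis by (simp add: bundled3_egf_def tree_egf_nth_odd)
  qed
qed

text \<open>The identity between the weight series and the cube of \<open>1 - fps_X\<close> is
  composed with \<open>bundled3_egf\<close>; the product form avoids division.\<close>

lemma bundled3_egf_deriv2: "fps_deriv (fps_deriv bundled3_egf) * (1 - bundled3_egf) ^ 3 = 1"
proof -
  let ?P = "Abs_fps (\<lambda>j. real (bundled3_weight j))" and ?T = bundled3_egf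
  \<comment> \<open>The zero constant term makes composition with \<open>?T\<close> compatible with
    products.\<close>
  have T0: "?T $ 0 = 0" by (simp add: bundled3_egf_def)
  have "?P * (1 - fps_X) ^ 3 = 1"
    unfolding bundled3_weight_gf by (simp add: fps_divide_unit inverse_mult_eq_1)
  then have "(?P * (1 - fps_X) ^ 3) oo ?T = 1" by simp
  then have "(?P oo ?T) * (1 - ?T) ^ 3 = 1"
    using T0 by (simp add: fps_compose_mult_distrib fps_compose_power[symmetric] fps_compose_sub_distrib)
  then show ?thesis
    using tree_egf_deriv2[of bundled3_weight] by (simp add: bundled3_egf_eq_tree_egf)
qed

section \<open>Solving the differential equation\<close>

lemma fps_eqI_deriv:
  fixes f g :: "'a :: {idom, semiring_char_0} fps"
  assumes "fps_deriv f = fps_deriv g" "f $ 0 = g $ 0"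
  shows "f = g"
  using assms fps_deriv_eq_iff[of f g] by simp

text \<open>
  The initial value problem is integrated once by the energy \<open>S'\<^sup>2 - 1 / S\<^sup>2\<close>; substituting
  the resulting first integral into \<open>(S\<^sup>2)'' = 2 S'\<^sup>2 + 2 S S''\<close> gives the constant \<open>-2\<close>.
\<close>

lemma fps_square_of_inverse_cube_ode:
  fixes S :: "real fps"
  assumes ode: "fps_deriv (fps_deriv S) * S ^ 3 = -1" and init: "S $ 0 = 1" "S $ 1 = 0"
  shows "S\<^sup>2 = 1 - fps_X\<^sup>2"
proof -
  define D where "D = fps_deriv S"
  define I where "I = inverse S"
  have SI: "S * I = 1" unfolding I_def using init by (metis inverse_mult_eq_1' zero_neq_one)
  have D': "fps_deriv D = - (I ^ 3)"
  proof -
    have "fps_deriv D = fps_deriv D * S ^ 3 * I ^ 3"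
      using SI by (simp add: mult.assoc flip: power_mult_distrib)
    also have "\<dots> = - (I ^ 3)" using ode by (simp add: D_def)
    finally show ?thesis .
  qed
  have I': "fps_deriv I = - D * I\<^sup>2"
    unfolding I_def D_def using init by (simp add: fps_inverse_deriv)
  have "D\<^sup>2 = I\<^sup>2 - 1"
  proof (rule fps_eqI_deriv)
    show "fps_deriv (D\<^sup>2) = fps_deriv (I\<^sup>2 - 1)"
      by (simp add: power2_eq_square power3_eq_cube D' I' algebra_simps)
    show "D\<^sup>2 $ 0 = (I\<^sup>2 - 1) $ 0"
      using init by (simp add: D_def I_def power2_eq_square)
  qed
  then have "fps_deriv (fps_deriv (S\<^sup>2)) = 2 * (I\<^sup>2 - 1) + 2 * (S * - (I ^ 3))"
    by (simp add: power2_eq_square D' flip: D_def)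
  also have "S * - (I ^ 3) = - (S * I) * I\<^sup>2"
    by (simp add: power2_eq_square power3_eq_cube)
  finally have "fps_deriv (fps_deriv (S\<^sup>2)) = -2"
    unfolding SI by (simp add: algebra_simps)
  moreover have "fps_deriv (fps_deriv (1 - fps_X\<^sup>2 :: real fps)) = -2"
    by (simp add: power2_eq_square)
  \<comment> \<open>Two integrations follow; their constants are fixed by 2 S(0) S'(0) = 0 and then
    by S(0) = 1.\<close>
  ultimately have "fps_deriv (S\<^sup>2) = fps_deriv (1 - fps_X\<^sup>2)"
    using init by (rule_tac fps_eqI_deriv) (simp_all add: power2_eq_square fps_mult_nth)
  then show ?thesis
    using init by (rule_tac fps_eqI_deriv) (simp_all add: power2_eq_square)
qed

lemma bundled3_egf_square: "(1 - bundled3_egf)\<^sup>2 = 1 - fps_X\<^sup>2"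
proof (rule fps_square_of_inverse_cube_ode)
  show "fps_deriv (fps_deriv (1 - bundled3_egf)) * (1 - bundled3_egf) ^ 3 = - 1"
    using bundled3_egf_deriv2 by simp
qed (simp_all add: bundled3_egf_def)

section \<open>Recurrence and closed form\<close>

text \<open>The start of the recurrence is the constant term of the differential equation: the
  factor 2 from differentiating cancels 2! in the coefficient.\<close>

lemma bundled3_count_1: "bundled3_count 1 = 1"
proof -
  have "(fps_deriv (fps_deriv bundled3_egf) * (1 - bundled3_egf) ^ 3) $ 0 = 1"
    by (simp only: bundled3_egf_deriv2) simp
  then show ?thesis by (simp add: bundled3_egf_def fps_power_zeroth)
qed

lemma bundled3_count_Suc:
  assumes "n \<ge> 1"
  shows "bundled3_count (Suc n) = (2 * n - 1) * (2 * n + 1) * bundled3_count n"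
proof -
  define S where "S = 1 - bundled3_egf"
  have sq: "S * S = 1 - fps_X\<^sup>2"
    using bundled3_egf_square by (simp add: S_def power2_eq_square)
  have "fps_deriv (S * S) = fps_deriv (1 - fps_X\<^sup>2)" by (simp only: sq)
  then have "2 * (S * fps_deriv S) = 2 * (- fps_X)"
    by (simp add: power2_eq_square algebra_simps)
  then have "S * fps_deriv S = - fps_X" by (simp only: mult_cancel_left) simp
  \<comment> \<open>A further factor \<open>S\<close> lets \<open>sq\<close> eliminate the square,
    leaving an equation linear in \<open>S\<close>.\<close>
  then have "S * S * fps_deriv S = - fps_X * S" by (simp add: mult.commute mult.left_commute)
  then have "fps_deriv S - fps_X\<^sup>2 * fps_deriv S = - (fps_X * S)"
    unfolding sq by (simp add: algebra_simps)
  \<comment> \<open>At this odd index the derivative terms involve exactly the coefficients of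
    \<open>S\<close> at \<open>2 * n + 2\<close> and \<open>2 * n\<close>.\<close>
  then have "(fps_deriv S - fps_X\<^sup>2 * fps_deriv S) $ (2 * n + 1) = (- (fps_X * S)) $ (2 * n + 1)"
    by simp
  then have "real (2 * n + 2) * S $ (2 * n + 2) - real (2 * n) * S $ (2 * n) = - S $ (2 * n)"
    using assms by (simp add: fps_X_power_mult_nth Suc_diff_le)
  then have rec: "real (2 * n + 2) * S $ (2 * n + 2) = (real (2 * n) - 1) * S $ (2 * n)"
    by (simp add: algebra_simps)
  \<comment> \<open>The constant 1 in \<open>S\<close> affects only index 0, hence the condition on
    \<open>k\<close>.\<close>
  have count: "real (bundled3_count k) = - S $ (2 * k) * fact (2 * k)" if "k \<ge> 1" for k
    using that by (simp add: S_def bundled3_egf_def)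
  have "real (bundled3_count (Suc n)) = - S $ (2 * n + 2) * fact (2 * n + 2)"
    using count[of "Suc n"] by simp
  also have "\<dots> = - (real (2 * n + 2) * S $ (2 * n + 2)) * (real (2 * n + 1) * fact (2 * n))"
    by (simp add: algebra_simps)
  also have "\<dots> = (real (2 * n) - 1) * real (2 * n + 1) * real (bundled3_count n)"
    unfolding rec count[OF assms] by simp
  also have "real (2 * n) - 1 = real (2 * n - 1)" using assms by simp
  finally show ?thesis by (metis of_nat_eq_iff of_nat_mult)
qed

lemma odd_dfact_Suc: "odd_dfact (Suc n) = (2 * n + 1) * odd_dfact n"
  by (simp add: odd_dfact_def)

theorem theorem3p3:
  shows "bundled3_egf = 1 - fps_radical root 2 (1 - fps_X\<^sup>2) \<and>
    (\<forall>n\<ge>1. bundled3_count n = odd_dfact (n - 1) * odd_dfact n)"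
proof (intro conjI allI impI)
  \<comment> \<open>Of the two square roots, the constant term 1 selects this one; the argument 1 of
    \<open>radical_unique\<close> stands for the exponent \<open>Suc 1\<close>.\<close>
  have "1 - bundled3_egf = fps_radical root 2 (1 - fps_X\<^sup>2)"
    using radical_unique[of root 1 "1 - fps_X\<^sup>2" "1 - bundled3_egf"] bundled3_egf_square
    by (simp add: bundled3_egf_def numeral_2_eq_2)
  then show "bundled3_egf = 1 - fps_radical root 2 (1 - fps_X\<^sup>2)"
    by (simp add: algebra_simps)
next
  fix n :: nat assume "n \<ge> 1"
  then show "bundled3_count n = odd_dfact (n - 1) * odd_dfact n"
  proof (induction n rule: dec_induct)
    case base
    then show ?case by (simp add: bundled3_count_1[simplified] odd_dfact_def)
  next
    case (step n)
    \<comment> \<open>The factor \<open>2 * n - 1 = 2 * k + 1\<close> raises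
      \<open>odd_dfact k\<close> to \<open>odd_dfact n\<close>, and \<open>2 * n + 1\<close> raises
      \<open>odd_dfact n\<close> to \<open>odd_dfact (Suc n)\<close>.\<close>
    then obtain k where "n = Suc k" by (cases n) auto
    then show ?case using bundled3_count_Suc[OF step.hyps(1)] step.IH
      by (simp add: odd_dfact_Suc algebra_simps)
  qed
qed

end
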